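(* Let $n\geq 1$, let $V$ be an $n$-dimensional vector space over $\mathbb{C}$, and let $A(z)=\sum_{m=0}^\infty A_m z^m\in \mathrm{End}(V)[[z]]$, with $A_m\in M_{n,n}(\mathbb{C})$, be such that $A_0$ is similar to a single $n\times n$ Jordan block with eigenvalue $0$. Then for every fixed integer $k\geq 1$ there exist $g_0\in \mathrm{GL}_n(\mathbb{C})$ and $g_1,\ldots,g_k\in M_{n,n}(\mathbb{C})$ such that, setting \[ g(z)=(I_n+g_kz^k)(I_n+g_{k-1}z^{k-1})\cdots(I_n+g_1z)\,g_0, \] the coefficients of $g(z)A(z)g(z)^{-1}=B(z)=\sum_{m=0}^\infty B_m z^m$ satisfy the following: (i) $B_0$ is the upper triangular nilpotent Jordan block of size $n$, i.e. $(B_0)_{i,i+1}=1$ for $1\leq i\leq n-1$ and all other entries of $B_0$ are $0$; (ii) for every $1\leq \ell\leq k$, all entries of $B_\ell$ outside the $n$-th (last) row are $0$; that is, $B_\ell$ has the form \[ B_\ell= \begin{pmatrix} 0 & 0 & \cdots & 0 & 0\\ \vdots & \vdots & \ddots & \vdots & \vdots\\ 0 & 0 & \cdots & 0 & 0\\ b_{n(\ell-1)+1} & b_{n(\ell-1)+2} & \cdots & b_{n\ell-1} & b_{n\ell} \end{pmatrix} \] for some complex numbers $b_{n(\ell-1)+1},\ldots,b_{n\ell}$.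
   Context: $\mathrm{End}(V)[[z]]$ is the ring of formal power series in $z$ with coefficients in $\mathrm{End}(V)$, identified with $M_{n,n}(\mathbb{C})$ by a choice of basis. An element of this ring is invertible if and only if its constant term is invertible; in particular the polynomial $g(z)$ in the claim is invertible, and $g(z)^{-1}$ denotes its inverse in $\mathrm{End}(V)[[z]]$. *)

theory Defs
  imports "Jordan_Normal_Form.Jordan_Normal_Form"
begin

text \<open>
  The ring \<open>R[[z]]\<close> of formal power series over a not necessarily commutative
  HOL-Algebra ring \<open>R\<close>; a series is its coefficient sequence. (The distribution's type
  \<open>'a fps\<close> is not applicable, since the \<open>n \<times> n\<close> matrices with \<open>n\<close> a
  natural number form a carrier set rather than a ring type.)
\<close>

definition pser_ring :: "('a, 'm) ring_scheme \<Rightarrow> (nat \<Rightarrow> 'a) ring" where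
  "pser_ring R = \<lparr>
     carrier = UNIV \<rightarrow> carrier R,
     mult = (\<lambda>p q m. \<Oplus>\<^bsub>R\<^esub>i \<in> {..m}. p i \<otimes>\<^bsub>R\<^esub> q (m - i)),
     one = (\<lambda>m. if m = 0 then \<one>\<^bsub>R\<^esub> else \<zero>\<^bsub>R\<^esub>),
     zero = (\<lambda>m. \<zero>\<^bsub>R\<^esub>),
     add = (\<lambda>p q m. p m \<oplus>\<^bsub>R\<^esub> q m)\<rparr>"

text \<open>The series \<open>a z\<^sup>d\<close>.\<close>

definition pser_monom :: "('a, 'm) ring_scheme \<Rightarrow> 'a \<Rightarrow> nat \<Rightarrow> nat \<Rightarrow> 'a" where
  "pser_monom R a d = (\<lambda>m. if m = d then a else \<zero>\<^bsub>R\<^esub>)"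

text \<open>The polynomial \<open>(1 + g\<^sub>k z\<^sup>k) (1 + g\<^sub>k\<^sub>-\<^sub>1 z\<^sup>k\<^sup>-\<^sup>1) \<cdots> (1 + g\<^sub>1 z) g\<^sub>0\<close>,
  with factors in this order.\<close>

primrec gauge_poly :: "('a, 'm) ring_scheme \<Rightarrow> (nat \<Rightarrow> 'a) \<Rightarrow> nat \<Rightarrow> nat \<Rightarrow> 'a" where
  "gauge_poly R g 0 = pser_monom R (g 0) 0"
| "gauge_poly R g (Suc k) =
     (\<one>\<^bsub>pser_ring R\<^esub> \<oplus>\<^bsub>pser_ring R\<^esub> pser_monom R (g (Suc k)) (Suc k))
       \<otimes>\<^bsub>pser_ring R\<^esub> gauge_poly R g k"

abbreviation cmat_ring :: "nat \<Rightarrow> complex mat ring" where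
  "cmat_ring n \<equiv> ring_mat TYPE(complex) n ()"

lemma ring_pser_ring:
  assumes "ring R"
  shows "ring (pser_ring R)"
proof -
  interpret R: ring R by fact
  have assoc: "(\<Oplus>\<^bsub>R\<^esub>j \<in> {..k}. (\<Oplus>\<^bsub>R\<^esub>i \<in> {..j}. a i \<otimes>\<^bsub>R\<^esub> b (j-i)) \<otimes>\<^bsub>R\<^esub> c (n-j)) =
      (\<Oplus>\<^bsub>R\<^esub>j \<in> {..k}. a j \<otimes>\<^bsub>R\<^esub> (\<Oplus>\<^bsub>R\<^esub>i \<in> {..k-j}. b i \<otimes>\<^bsub>R\<^esub> c (n-j-i)))"
    if "a \<in> UNIV \<rightarrow> carrier R" "b \<in> UNIV \<rightarrow> carrier R" "c \<in> UNIV \<rightarrow> carrier R" "k \<le> n"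
    for a b c :: "nat \<Rightarrow> 'a" and k n
    using that
  proof (induct k)
    case 0
    then show ?case by (simp add: Pi_def R.m_assoc)
  next
    case (Suc k)
    then show ?case
      by (simp cong: R.finsum_cong
            add: Suc_diff_le Pi_def R.l_distr R.r_distr R.m_assoc)
         (simp cong: R.finsum_cong add: Pi_def R.a_ac R.finsum_ldistr R.m_assoc)
  qed
  have l_one: "(\<Oplus>\<^bsub>R\<^esub>i\<in>{..m}. (if i = 0 then \<one>\<^bsub>R\<^esub> else \<zero>\<^bsub>R\<^esub>) \<otimes>\<^bsub>R\<^esub> p (m - i)) = p m"
    if "p \<in> UNIV \<rightarrow> carrier R" for p :: "nat \<Rightarrow> 'a" and m
  proof -
    have "(\<Oplus>\<^bsub>R\<^esub>i\<in>{..m}. (if i = 0 then \<one>\<^bsub>R\<^esub> else \<zero>\<^bsub>R\<^esub>) \<otimes>\<^bsub>R\<^esub> p (m - i))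
        = (\<Oplus>\<^bsub>R\<^esub>i\<in>{..m}. if 0 = i then p (m - i) else \<zero>\<^bsub>R\<^esub>)"
      using that by (intro R.finsum_cong') (auto simp: Pi_def)
    also have "\<dots> = p m"
      using that R.finsum_singleton[of 0 "{..m}" "\<lambda>i. p (m - i)"] by (simp add: Pi_def)
    finally show ?thesis .
  qed
  have r_one: "(\<Oplus>\<^bsub>R\<^esub>i\<in>{..m}. p i \<otimes>\<^bsub>R\<^esub> (if m - i = 0 then \<one>\<^bsub>R\<^esub> else \<zero>\<^bsub>R\<^esub>)) = p m"
    if "p \<in> UNIV \<rightarrow> carrier R" for p :: "nat \<Rightarrow> 'a" and m
  proof -
    have "(\<Oplus>\<^bsub>R\<^esub>i\<in>{..m}. p i \<otimes>\<^bsub>R\<^esub> (if m - i = 0 then \<one>\<^bsub>R\<^esub> else \<zero>\<^bsub>R\<^esub>))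
        = (\<Oplus>\<^bsub>R\<^esub>i\<in>{..m}. if m = i then p i else \<zero>\<^bsub>R\<^esub>)"
      using that by (intro R.finsum_cong') (auto simp: Pi_def)
    also have "\<dots> = p m"
      using that R.finsum_singleton[of m "{..m}" p] by (simp add: Pi_def)
    finally show ?thesis .
  qed
  show ?thesis
  proof (intro ringI abelian_groupI monoidI, goal_cases)
    case (6 x)
    then show ?case
      by (intro bexI[of _ "\<lambda>m. \<ominus>\<^bsub>R\<^esub> x m"]) (auto simp: pser_ring_def Pi_def R.l_neg)
  next
    case (9 x y z)
    then show ?case by (auto simp: pser_ring_def assoc)
  next
    case (10 x)
    then show ?case using l_one[of x] by (simp add: pser_ring_def)
  next
    case (11 x)
    then show ?case using r_one[of x] by (simp add: pser_ring_def)
  next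
    case (12 x y z)
    then show ?case
      by (auto simp: pser_ring_def fun_eq_iff Pi_def R.l_distr R.finsum_addf)
  next
    case (13 x y z)
    then show ?case
      by (auto simp: pser_ring_def fun_eq_iff Pi_def R.r_distr R.finsum_addf)
  qed (auto simp: pser_ring_def Pi_def R.a_ac)
qed

end

theory Submission
  imports Defs
begin

text \<open>
  Induction on \<open>k\<close>. Conjugation by \<open>1 + X z\<^sup>k\<close> leaves the coefficients below degree \<open>k\<close>
  unchanged and adds \<open>X B\<^sub>0 - B\<^sub>0 X\<close> to \<open>B\<^sub>k\<close>. When \<open>B\<^sub>0 = J\<close> is the Jordan block, \<open>J X\<close>
  is \<open>X\<close> with its rows moved up and \<open>X J\<close> is \<open>X\<close> with its columns moved right, so
  the rows of an \<open>X\<close> that clears all rows of \<open>B\<^sub>k\<close> but the last can be computed one after the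
  other.
\<close>

text \<open>Serves to turn conjugation by a product of units of the noncommutative series ring into
  successive conjugations.\<close>

lemma (in monoid) inv_mult_Units:
  assumes x: "x \<in> Units G" and y: "y \<in> Units G"
  shows "inv (x \<otimes> y) = inv y \<otimes> inv x"
proof (rule inv_char)
  note c = Units_closed[OF x] Units_closed[OF y] Units_inv_closed[OF x] Units_inv_closed[OF y]
  have "y \<otimes> (inv y \<otimes> inv x) = inv x"
    using c y by (simp flip: m_assoc)
  then show "x \<otimes> y \<otimes> (inv y \<otimes> inv x) = \<one>"
    using c x by (simp add: m_assoc)
  have "inv x \<otimes> (x \<otimes> y) = y"
    using c x by (simp flip: m_assoc)
  then show "inv y \<otimes> inv x \<otimes> (x \<otimes> y) = \<one>"
    using c y by (simp add: m_assoc)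
qed (use x y in \<open>simp_all add: Units_closed\<close>)

section \<open>Coefficients, units and conjugation in the power series ring\<close>

context ring
begin

lemma pser_ring_ring: "ring (pser_ring R)"
  by (rule ring_pser_ring) unfold_locales

lemma pser_carrier_iff: "p \<in> carrier (pser_ring R) \<longleftrightarrow> (\<forall>m. p m \<in> carrier R)"
  by (auto simp: pser_ring_def)

lemma pser_add_coeff: "(p \<oplus>\<^bsub>pser_ring R\<^esub> q) m = p m \<oplus> q m"
  by (simp add: pser_ring_def)

lemma pser_one_coeff: "\<one>\<^bsub>pser_ring R\<^esub> m = (if m = 0 then \<one> else \<zero>)"
  by (simp add: pser_ring_def)

lemma pser_monom_closed:
  "a \<in> carrier R \<Longrightarrow> pser_monom R a d \<in> carrier (pser_ring R)"
  by (simp add: pser_carrier_iff pser_monom_def)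

lemma pser_monom_mult_left:
  assumes "a \<in> carrier R" "p \<in> carrier (pser_ring R)"
  shows "(pser_monom R a d \<otimes>\<^bsub>pser_ring R\<^esub> p) m
    = (if d \<le> m then a \<otimes> p (m - d) else \<zero>)"
proof -
  have p: "p i \<in> carrier R" for i
    using assms(2) by (simp add: pser_carrier_iff)
  have "(pser_monom R a d \<otimes>\<^bsub>pser_ring R\<^esub> p) m
      = (\<Oplus>i\<in>{..m}. if d = i then a \<otimes> p (m - i) else \<zero>)"
    using assms p by (auto simp: pser_ring_def pser_monom_def intro!: finsum_cong')
  also have "\<dots> = (if d \<le> m then a \<otimes> p (m - d) else \<zero>)"
  proof (cases "d \<le> m")
    case True
    then show ?thesis
      using assms p finsum_singleton[of d "{..m}" "\<lambda>i. a \<otimes> p (m - i)"] by auto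
  next
    case False
    then have "(\<Oplus>i\<in>{..m}. if d = i then a \<otimes> p (m - i) else \<zero>) = (\<Oplus>i\<in>{..m}. \<zero>)"
      using assms p by (intro finsum_cong') auto
    with False show ?thesis by simp
  qed
  finally show ?thesis .
qed

lemma pser_monom_mult_right:
  assumes "a \<in> carrier R" "p \<in> carrier (pser_ring R)"
  shows "(p \<otimes>\<^bsub>pser_ring R\<^esub> pser_monom R a d) m
    = (if d \<le> m then p (m - d) \<otimes> a else \<zero>)"
proof -
  have p: "p i \<in> carrier R" for i
    using assms(2) by (simp add: pser_carrier_iff)
  have "(p \<otimes>\<^bsub>pser_ring R\<^esub> pser_monom R a d) m
      = (\<Oplus>i\<in>{..m}. if m - i = d then p i \<otimes> a else \<zero>)"
    using assms p by (auto simp: pser_ring_def pser_monom_def intro!: finsum_cong')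
  also have "\<dots> = (if d \<le> m then p (m - d) \<otimes> a else \<zero>)"
  proof (cases "d \<le> m")
    case True
    \<comment> \<open>Solving the index condition for \<open>i\<close> gives the shape of
      \<open>finsum_singleton\<close>; this is sound because both \<open>i\<close> and
      \<open>d\<close> are at most \<open>m\<close>, so the subtractions are not truncated.\<close>
    then have "(\<Oplus>i\<in>{..m}. if m - i = d then p i \<otimes> a else \<zero>)
        = (\<Oplus>i\<in>{..m}. if m - d = i then p i \<otimes> a else \<zero>)"
      using assms p by (intro finsum_cong') auto
    with True show ?thesis
      using assms p finsum_singleton[of "m - d" "{..m}" "\<lambda>i. p i \<otimes> a"] by auto
  next
    case False
    then have "(\<Oplus>i\<in>{..m}. if m - i = d then p i \<otimes> a else \<zero>) = (\<Oplus>i\<in>{..m}. \<zero>)"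
      using assms p by (intro finsum_cong') auto
    with False show ?thesis by simp
  qed
  finally show ?thesis .
qed

lemma pser_one_plus_monom_mult_left:
  assumes "a \<in> carrier R" "p \<in> carrier (pser_ring R)"
  shows "((\<one>\<^bsub>pser_ring R\<^esub> \<oplus>\<^bsub>pser_ring R\<^esub> pser_monom R a d) \<otimes>\<^bsub>pser_ring R\<^esub> p) m
    = p m \<oplus> (if d \<le> m then a \<otimes> p (m - d) else \<zero>)"
proof -
  interpret S: ring "pser_ring R" by (rule pser_ring_ring)
  show ?thesis
    using assms by (simp add: S.l_distr pser_monom_closed pser_add_coeff pser_monom_mult_left)
qed

lemma pser_one_plus_monom_mult_right:
  assumes "a \<in> carrier R" "p \<in> carrier (pser_ring R)"
  shows "(p \<otimes>\<^bsub>pser_ring R\<^esub> (\<one>\<^bsub>pser_ring R\<^esub> \<oplus>\<^bsub>pser_ring R\<^esub> pser_monom R a d)) m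
    = p m \<oplus> (if d \<le> m then p (m - d) \<otimes> a else \<zero>)"
proof -
  interpret S: ring "pser_ring R" by (rule pser_ring_ring)
  show ?thesis
    using assms by (simp add: S.r_distr pser_monom_closed pser_add_coeff pser_monom_mult_right)
qed

lemma pser_monom_0_Units:
  assumes "a \<in> Units R"
  shows "pser_monom R a 0 \<in> Units (pser_ring R)"
proof -
  interpret S: ring "pser_ring R" by (rule pser_ring_ring)
  have "pser_monom R a 0 \<otimes>\<^bsub>pser_ring R\<^esub> pser_monom R (inv a) 0 = \<one>\<^bsub>pser_ring R\<^esub>"
    "pser_monom R (inv a) 0 \<otimes>\<^bsub>pser_ring R\<^esub> pser_monom R a 0 = \<one>\<^bsub>pser_ring R\<^esub>"
    using assms
    by (simp_all add: fun_eq_iff pser_monom_mult_left pser_monom_closed pser_one_coeff Units_closed)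
      (simp_all add: pser_monom_def Units_closed)
  then show ?thesis
    using assms by (auto simp: Units_def[of "pser_ring R"] pser_monom_closed
        intro!: bexI[of _ "pser_monom R (inv a) 0"])
qed

text \<open>The inverse is the geometric series \<open>q\<close>, the sum of (-a)^i z^(d i) over all
  i. Since \<open>d > 0\<close>, each coefficient receives at most one term.\<close>

lemma pser_one_plus_monom_Units:
  assumes a: "a \<in> carrier R" and d: "d > 0"
  shows "\<one>\<^bsub>pser_ring R\<^esub> \<oplus>\<^bsub>pser_ring R\<^esub> pser_monom R a d \<in> Units (pser_ring R)" (is "?u \<in> _")
proof -
  interpret S: ring "pser_ring R" by (rule pser_ring_ring)
  define q where "q m = (if d dvd m then (\<ominus> a) [^] (m div d) else \<zero>)" for m
  have q: "q \<in> carrier (pser_ring R)"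
    using a by (simp add: pser_carrier_iff q_def)
  have q0: "q m = \<one>\<^bsub>pser_ring R\<^esub> m" if "m < d" for m
    using that d by (auto simp: q_def pser_one_coeff dest: dvd_imp_le)
  \<comment> \<open>Both forms of the recurrence hold because powers of -a commute with -a. The
    first cancels the coefficients of \<open>?u\<close> times \<open>q\<close> from degree
    \<open>d\<close> on, the second those of \<open>q\<close> times \<open>?u\<close>.\<close>
  have step: "q m = (\<ominus> a) \<otimes> q (m - d)" "q m = q (m - d) \<otimes> (\<ominus> a)" if "d \<le> m" for m
  proof -
    have "d dvd m \<longleftrightarrow> d dvd m - d" "m div d = Suc ((m - d) div d)"
      using that d by (auto simp: le_div_geq dvd_minus_self)
    then show "q m = (\<ominus> a) \<otimes> q (m - d)" "q m = q (m - d) \<otimes> (\<ominus> a)"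
      using a nat_pow_Suc2[of "\<ominus> a"] by (auto simp: q_def)
  qed
  have qm: "q i \<in> carrier R" for i
    using q by (simp add: pser_carrier_iff)
  have "?u \<otimes>\<^bsub>pser_ring R\<^esub> q = \<one>\<^bsub>pser_ring R\<^esub>"
  proof
    fix m
    show "(?u \<otimes>\<^bsub>pser_ring R\<^esub> q) m = \<one>\<^bsub>pser_ring R\<^esub> m"
      using d qm a
      by (cases "m < d")
        (auto simp: pser_one_plus_monom_mult_left a q q0 step(1) pser_one_coeff l_minus l_neg)
  qed
  moreover have "q \<otimes>\<^bsub>pser_ring R\<^esub> ?u = \<one>\<^bsub>pser_ring R\<^esub>"
  proof
    fix m
    show "(q \<otimes>\<^bsub>pser_ring R\<^esub> ?u) m = \<one>\<^bsub>pser_ring R\<^esub> m"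
      using d qm a
      by (cases "m < d")
        (auto simp: pser_one_plus_monom_mult_right a q q0 step(2) pser_one_coeff r_minus l_neg)
  qed
  ultimately show ?thesis
    using q a by (auto simp: Units_def[of "pser_ring R"] pser_monom_closed intro!: bexI[of _ q])
qed

text \<open>The inverse of \<open>U\<close> is never expanded: the coefficients of C U = U B are
  compared instead. Below degree \<open>d\<close> the factor \<open>U\<close> acts as 1 on both
  sides.\<close>

lemma pser_conj_one_plus_monom:
  assumes X: "X \<in> carrier R" and d: "d > 0" and B: "B \<in> carrier (pser_ring R)"
    and U: "U = \<one>\<^bsub>pser_ring R\<^esub> \<oplus>\<^bsub>pser_ring R\<^esub> pser_monom R X d"
    and C: "C = U \<otimes>\<^bsub>pser_ring R\<^esub> B \<otimes>\<^bsub>pser_ring R\<^esub> inv\<^bsub>pser_ring R\<^esub> U"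
  shows "m < d \<Longrightarrow> C m = B m" and "C d = (B d \<oplus> X \<otimes> B 0) \<ominus> B 0 \<otimes> X"
proof -
  interpret S: ring "pser_ring R" by (rule pser_ring_ring)
  have uU: "U \<in> Units (pser_ring R)"
    using X d pser_one_plus_monom_Units by (simp add: U)
  have Cc: "C \<in> carrier (pser_ring R)"
    using uU B by (simp add: C S.Units_closed)
  have "C \<otimes>\<^bsub>pser_ring R\<^esub> U = U \<otimes>\<^bsub>pser_ring R\<^esub> B"
    using uU B by (simp add: C S.m_assoc S.Units_closed)
  then have eq: "C m \<oplus> (if d \<le> m then C (m - d) \<otimes> X else \<zero>)
      = B m \<oplus> (if d \<le> m then X \<otimes> B (m - d) else \<zero>)" for m
    using pser_one_plus_monom_mult_left[OF X B, of d m]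
      pser_one_plus_monom_mult_right[OF X Cc, of d m] by (simp add: U)
  have Bm: "B i \<in> carrier R" and Cm: "C i \<in> carrier R" for i
    using B Cc by (simp_all add: pser_carrier_iff)
  show low: "C m = B m" if "m < d" for m
    using eq[of m] that Bm Cm by simp
  have "C d = (C d \<oplus> B 0 \<otimes> X) \<ominus> B 0 \<otimes> X"
    using Bm Cm X by (simp add: minus_eq a_assoc r_neg)
  \<comment> \<open>Coefficient \<open>d\<close> of C U = U B contains C_0 X; as 0 <
    \<open>d\<close>, the case below \<open>d\<close> allows C_0 to be replaced by B_0.\<close>
  also have "C d \<oplus> B 0 \<otimes> X = B d \<oplus> X \<otimes> B 0"
    using eq[of d] low[OF d] by simp
  finally show "C d = (B d \<oplus> X \<otimes> B 0) \<ominus> B 0 \<otimes> X" .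
qed

end

text \<open>Lets the induction step choose a new matrix at index \<open>Suc k\<close> without
  disturbing the product already built.\<close>

lemma gauge_poly_cong:
  "(\<And>l. l \<le> k \<Longrightarrow> g l = h l) \<Longrightarrow> gauge_poly R g k = gauge_poly R h k"
  by (induction k) simp_all

section \<open>Commutators with the nilpotent Jordan block\<close>

text \<open>The solution \<open>X\<close> with first row \<open>0\<close> of \<open>M + X J = J X\<close> outside the last row.\<close>

primrec row_shift_sol :: "'a :: ring_1 mat \<Rightarrow> nat \<Rightarrow> nat \<Rightarrow> 'a" where
  "row_shift_sol M 0 j = 0"
| "row_shift_sol M (Suc i) j = M $$ (i, j) + (if j = 0 then 0 else row_shift_sol M i (j - 1))"

lemma jordan_block_zero_mult:
  fixes X :: "'a :: ring_1 mat"
  assumes "X \<in> carrier_mat n n" "i < n" "j < n"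
  shows "(jordan_block n 0 * X) $$ (i, j) = (if Suc i < n then X $$ (Suc i, j) else 0)"
    and "(X * jordan_block n 0) $$ (i, j) = (if j = 0 then 0 else X $$ (i, j - 1))"
proof -
  have "(jordan_block n 0 * X) $$ (i, j) = (\<Sum>l\<in>{0..<n}. jordan_block n 0 $$ (i, l) * X $$ (l, j))"
    using assms by (simp add: scalar_prod_def)
  also have "\<dots> = (\<Sum>l\<in>{0..<n}. if l = Suc i then X $$ (l, j) else 0)"
    using assms by (intro sum.cong) auto
  finally show "(jordan_block n 0 * X) $$ (i, j) = (if Suc i < n then X $$ (Suc i, j) else 0)"
    by simp
  have "(X * jordan_block n 0) $$ (i, j) = (\<Sum>l\<in>{0..<n}. X $$ (i, l) * jordan_block n 0 $$ (l, j))"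
    using assms by (simp add: scalar_prod_def)
  \<comment> \<open>For \<open>j = 0\<close> the truncated \<open>j - 1\<close> is 0, so the outer
    test still selects \<open>l = 0\<close>; the inner test makes that summand vanish, as column 0
    of the block is zero.\<close>
  also have "\<dots> = (\<Sum>l\<in>{0..<n}. if l = j - 1 then (if j = 0 then 0 else X $$ (i, l)) else 0)"
    using assms by (intro sum.cong) auto
  finally show "(X * jordan_block n 0) $$ (i, j) = (if j = 0 then 0 else X $$ (i, j - 1))"
    using assms by (simp add: less_imp_diff_less)
qed

text \<open>Row i of the equation reads X(i+1, j) = M(i, j) + X(i, j-1), with the last term absent
  for j = 0. This is the recursion of \<open>row_shift_sol\<close>; the last row is excluded because
  there is no row n of X left to choose.\<close>

lemma ex_commutator_jordan_block:
  fixes M :: "'a :: ring_1 mat"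
  assumes M: "M \<in> carrier_mat n n"
  obtains X where "X \<in> carrier_mat n n"
    "\<And>i j. Suc i < n \<Longrightarrow> j < n \<Longrightarrow>
      (M + X * jordan_block n 0) $$ (i, j) = (jordan_block n 0 * X) $$ (i, j)"
proof
  let ?X = "mat n n (\<lambda>(i, j). row_shift_sol M i j)"
  show X: "?X \<in> carrier_mat n n" by simp
  fix i j assume "Suc i < n" "j < n"
  with M show "(M + ?X * jordan_block n 0) $$ (i, j) = (jordan_block n 0 * ?X) $$ (i, j)"
    by (simp add: jordan_block_zero_mult[OF X] del: index_mult_mat(1))
qed

section \<open>Normalisation of the series degree by degree\<close>

theorem theorem2p1:
  fixes n k :: nat and A :: "nat \<Rightarrow> complex mat"
  assumes "n \<ge> 1"
    and "A \<in> carrier (pser_ring (cmat_ring n))"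
    and "similar_mat (A 0) (jordan_block n 0)"
    and "k \<ge> 1"
  shows "\<exists>g :: nat \<Rightarrow> complex mat.
    g 0 \<in> Units (cmat_ring n) \<and>
    (\<forall>l \<in> {1..k}. g l \<in> carrier_mat n n) \<and>
    (let S = pser_ring (cmat_ring n);
         G = gauge_poly (cmat_ring n) g k;
         B = G \<otimes>\<^bsub>S\<^esub> A \<otimes>\<^bsub>S\<^esub> inv\<^bsub>S\<^esub> G
     in G \<in> Units S \<and>
        B 0 = jordan_block n 0 \<and>
        (\<exists>b :: nat \<Rightarrow> complex. \<forall>l \<in> {1..k}.
           B l = mat n n (\<lambda>(i, j). if i = n - 1 then b (n * (l - 1) + (j + 1)) else 0)))"
proof -
  define R where "R = cmat_ring n"
  define S where "S = pser_ring R"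
  interpret R: ring R unfolding R_def by (rule ring_mat)
  interpret S: ring S unfolding S_def by (rule R.pser_ring_ring)
  have carR: "carrier R = carrier_mat n n" and multR: "\<And>x y. x \<otimes>\<^bsub>R\<^esub> y = x * y"
    and addR: "\<And>x y. x \<oplus>\<^bsub>R\<^esub> y = x + y" and oneR: "\<one>\<^bsub>R\<^esub> = 1\<^sub>m n"
    by (simp_all add: R_def ring_mat_simps)
  have A: "A \<in> carrier S" using assms(2) by (simp add: S_def R_def)
  define gB where "gB g k = gauge_poly R g k \<otimes>\<^bsub>S\<^esub> A \<otimes>\<^bsub>S\<^esub> inv\<^bsub>S\<^esub> gauge_poly R g k" for g k
  \<comment> \<open>The induction starts at 0, where only the constant term is constrained. The
    shape of the coefficients is kept as vanishing entries above the last row; the numbers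
    \<open>b\<close> are read off at the end.\<close>
  have "\<exists>g. g 0 \<in> Units R \<and> (\<forall>l \<in> {1..k}. g l \<in> carrier R) \<and>
      gauge_poly R g k \<in> Units S \<and> gB g k 0 = jordan_block n 0 \<and>
      (\<forall>l \<in> {1..k}. \<forall>i j. Suc i < n \<longrightarrow> j < n \<longrightarrow> gB g k l $$ (i, j) = 0)" for k
  proof (induction k)
    case 0
    have A0: "A 0 \<in> carrier_mat n n"
      using A R.pser_carrier_iff by (simp add: S_def carR)
    obtain P Q where PQ: "similar_mat_wit (A 0) (jordan_block n 0) P Q"
      using assms(3) by (auto simp: similar_mat_def)
    note w = similar_mat_witD2[OF A0 PQ]
    \<comment> \<open>The witnesses satisfy A_0 = P J Q with P and Q mutually inverse, so Q A_0 P =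
      J and \<open>Q\<close> serves as g_0.\<close>
    have Q: "Q \<in> Units R"
      using w by (auto simp: Units_def carR multR oneR)
    let ?G = "gauge_poly R (\<lambda>_. Q) 0" and ?C = "gB (\<lambda>_. Q) 0"
    have G: "?G \<in> Units S"
      using R.pser_monom_0_Units[OF Q] by (simp add: S_def)
    have C: "?C \<in> carrier S"
      using A G by (simp add: gB_def S.Units_closed)
    have "?C \<otimes>\<^bsub>S\<^esub> ?G = ?G \<otimes>\<^bsub>S\<^esub> A"
      using A G by (simp add: gB_def S.m_assoc S.Units_closed)
    then have "(?C \<otimes>\<^bsub>S\<^esub> ?G) 0 = (?G \<otimes>\<^bsub>S\<^esub> A) 0"
      by simp
    then have eq: "?C 0 * Q = Q * A 0"
      using C A Q by (simp add: S_def R.pser_monom_mult_left R.pser_monom_mult_right multR R.Units_closed)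
    have C0: "?C 0 \<in> carrier_mat n n"
      using C R.pser_carrier_iff by (simp add: S_def carR)
    have "?C 0 = ?C 0 * (Q * P)"
      using w C0 by simp
    also have "\<dots> = (?C 0 * Q) * P"
      using w C0 by (intro assoc_mult_mat[symmetric]) auto
    also have "\<dots> = jordan_block n 0"
      using similar_mat_witD(3)[OF refl similar_mat_wit_sym[OF PQ]] by (simp only: eq)
    finally show ?case
      using Q G by (intro exI[of _ "\<lambda>_. Q"]) auto
  next
    case (Suc k)
    then obtain g where g: "g 0 \<in> Units R" "\<And>l. l \<in> {1..k} \<Longrightarrow> g l \<in> carrier R"
      "gauge_poly R g k \<in> Units S" "gB g k 0 = jordan_block n 0"
      "\<And>l i j. l \<in> {1..k} \<Longrightarrow> Suc i < n \<Longrightarrow> j < n \<Longrightarrow> gB g k l $$ (i, j) = 0"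
      by blast
    define B where "B = gB g k"
    have B: "B \<in> carrier S"
      using A g by (simp add: gB_def B_def S.Units_closed)
    then have Bm: "B m \<in> carrier_mat n n" for m
      using R.pser_carrier_iff by (simp add: S_def carR)
    obtain X where X: "X \<in> carrier_mat n n" and XJ:
      "\<And>i j. Suc i < n \<Longrightarrow> j < n \<Longrightarrow>
        (B (Suc k) + X * jordan_block n 0) $$ (i, j) = (jordan_block n 0 * X) $$ (i, j)"
      using ex_commutator_jordan_block[OF Bm] by blast
    define h where "h = g(Suc k := X)"
    define U where "U = \<one>\<^bsub>S\<^esub> \<oplus>\<^bsub>S\<^esub> pser_monom R X (Suc k)"
    have U: "U \<in> Units S"
      using R.pser_one_plus_monom_Units[of X "Suc k"] X by (simp add: S_def U_def carR)
    have "gauge_poly R h k = gauge_poly R g k"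
      by (rule gauge_poly_cong) (simp add: h_def)
    then have poly: "gauge_poly R h (Suc k) = U \<otimes>\<^bsub>S\<^esub> gauge_poly R g k"
      by (simp add: U_def S_def h_def)
    \<comment> \<open>The new factor stands leftmost, so the new conjugate of \<open>A\<close> is
      the conjugate by \<open>U\<close> of the old result \<open>B\<close>.\<close>
    have conj: "gB h (Suc k) = U \<otimes>\<^bsub>S\<^esub> B \<otimes>\<^bsub>S\<^esub> inv\<^bsub>S\<^esub> U"
      using U g(3) A by (simp add: gB_def B_def poly S.inv_mult_Units S.m_assoc S.Units_closed
          del: gauge_poly.simps)
    have low: "gB h (Suc k) m = B m" if "m < Suc k" for m
      using R.pser_conj_one_plus_monom(1)[of X "Suc k" B U "gB h (Suc k)" m] that X B conj
      by (simp add: carR U_def S_def)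
    have top: "gB h (Suc k) (Suc k) =
        (B (Suc k) + X * jordan_block n 0) \<ominus>\<^bsub>R\<^esub> jordan_block n 0 * X"
      using R.pser_conj_one_plus_monom(2)[of X "Suc k" B U "gB h (Suc k)"] X B conj g(4)
      by (simp add: carR U_def S_def multR addR B_def)
    \<comment> \<open>Subtraction in \<open>R\<close> comes from the abstract additive inverse, so
      its entries are recovered from (x - y) + y = x, where the sum is the matrix sum.\<close>
    have minus: "(x \<ominus>\<^bsub>R\<^esub> y) $$ (i, j) = x $$ (i, j) - y $$ (i, j)"
      if "x \<in> carrier_mat n n" "y \<in> carrier_mat n n" "i < n" "j < n" for x y i j
    proof -
      have c: "x \<ominus>\<^bsub>R\<^esub> y \<in> carrier_mat n n"
        using that R.minus_closed by (simp add: carR)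
      have "(x \<ominus>\<^bsub>R\<^esub> y) + y = x"
        using that by (simp add: R.minus_eq R.a_assoc R.l_neg flip: carR addR)
      then have "((x \<ominus>\<^bsub>R\<^esub> y) + y) $$ (i, j) = x $$ (i, j)"
        by simp
      then show ?thesis using that c by (simp add: eq_diff_eq)
    qed
    have "gB h (Suc k) l $$ (i, j) = 0" if "l \<in> {1..Suc k}" "Suc i < n" "j < n" for l i j
    proof (cases "l = Suc k")
      case True
      let ?Y = "B (Suc k) + X * jordan_block n 0" and ?Z = "jordan_block n 0 * X"
      have "?Z \<in> carrier_mat n n" "?Y \<in> carrier_mat n n"
        using X by (auto intro!: mult_carrier_mat add_carrier_mat)
      then have "(?Y \<ominus>\<^bsub>R\<^esub> ?Z) $$ (i, j) = ?Y $$ (i, j) - ?Z $$ (i, j)"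
        using that by (intro minus) auto
      also have "\<dots> = 0"
        using XJ[OF that(2,3)] by (simp only: diff_self)
      finally show ?thesis
        by (simp only: True top)
    next
      case False
      with that g(5)[of l i j] show ?thesis by (simp add: low B_def)
    qed
    moreover have "gauge_poly R h (Suc k) \<in> Units S"
      using U g(3) by (simp add: poly del: gauge_poly.simps)
    moreover have "h 0 \<in> Units R" "\<forall>l \<in> {1..Suc k}. h l \<in> carrier R"
      using g X by (auto simp: h_def carR le_Suc_eq)
    moreover have "gB h (Suc k) 0 = jordan_block n 0"
      using low[of 0] g(4) by (simp add: B_def)
    ultimately show ?case
      by blast
  qed
  from this[of k] obtain g where g: "g 0 \<in> Units R" "\<forall>l \<in> {1..k}. g l \<in> carrier R"
    "gauge_poly R g k \<in> Units S" "gB g k 0 = jordan_block n 0"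
    and rows: "\<forall>l \<in> {1..k}. \<forall>i j. Suc i < n \<longrightarrow> j < n \<longrightarrow> gB g k l $$ (i, j) = 0"
    by blast
  have "gB g k \<in> carrier S"
    using A g by (simp add: gB_def S.Units_closed)
  then have Bm: "gB g k m \<in> carrier_mat n n" for m
    using R.pser_carrier_iff by (simp add: S_def carR)
  \<comment> \<open>The last rows are numbered consecutively from 1. For x = n(l-1) + (j+1) with j <
    n, division of x - 1 by n has quotient l - 1 and remainder j; \<open>Suc\<close> restores
    l.\<close>
  define b where "b x = gB g k (Suc ((x - 1) div n)) $$ (n - 1, (x - 1) mod n)" for x
  have b: "b (n * (l - 1) + (j + 1)) = gB g k l $$ (n - 1, j)" if "l \<in> {1..k}" "j < n" for l j
    using that by (simp add: b_def)
  have last_row: "gB g k l = mat n n (\<lambda>(i, j). if i = n - 1 then b (n * (l - 1) + (j + 1)) else 0)"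
    (is "_ = ?M") if l: "l \<in> {1..k}" for l
  proof (rule eq_matI)
    fix i j
    assume "i < dim_row ?M" "j < dim_col ?M"
    then have ij: "i < n" "j < n" by simp_all
    show "gB g k l $$ (i, j) = ?M $$ (i, j)"
    proof (cases "i = n - 1")
      case True
      with ij show ?thesis
        by (simp only: index_mat b[OF l] split refl if_True)
    next
      case False
      with ij have "Suc i < n" by linarith
      with rows l ij have "gB g k l $$ (i, j) = 0" by blast
      with False ij show ?thesis by (simp only: index_mat split if_False)
    qed
  qed (simp_all only: carrier_matD[OF Bm] dim_row_mat dim_col_mat)
  show ?thesis
    unfolding Let_def R_def[symmetric] S_def[symmetric] gB_def[symmetric] carR[symmetric]
    using g last_row by blast
qed

end
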